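(* Assume $H>K$ and $H>1/2$. For every $N\in\{1,2,\dots\}$, there are constants $c_N>0$ and $\delta_N>0$ such that, for all $s,t\in T_N$ with $0<|t-s|<\delta_N$, $$\mathbb E\big[|Y(t)-Y(s)|^2\big]\ge c_N|t-s|^{2K}.$$
   Context: Let $(\Omega,\mathcal F,\mathbb P)$ be a probability space, $H\in(0,1)$, and let $W_H=\{W_H(t):0\le t\le 1\}$ be a continuous fractional Brownian motion with Hurst parameter $H$, i.e. a continuous centered Gaussian process with $\mathbb E[W_H(s)W_H(t)]=\frac12(s^{2H}+t^{2H}-|t-s|^{2H})$. Let $\kappa:[0,1]\to[0,1]$ be a deterministic function with $\kappa(0)=0$, $\kappa(1)=1$, Hölder continuous with some exponent $\tau\in(H,1]$, and put $B_H(u):=W_H(u)-\kappa(u)W_H(1)$, $0\le u\le1$. Let $\alpha\in(0,1)$ and $b\in\{2,3,\dots\}$. The fractional Wiener--Weierstrass bridge with parameters $\alpha,b,H$ is $$Y(t):=\sum_{n=0}^\infty\alpha^nB_H(\{b^nt\}),\qquad 0\le t\le1,$$ where $\{x\}$ denotes the fractional part of $x\ge0$. Put $K:=\min\{1,-\log_b\alpha\}$. For $N\in\{1,2,\dots\}$, $T_N$ is the set of points $x\in[0,1]$ such that $\{b^kx\}\in[b^{-N},1-b^{-N}]$ for every integer $k\ge0$. *)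

theory Defs
  imports "HOL-Probability.Probability"
begin

text \<open>One-dimensional Gaussian law; a point mass counts as a (degenerate) Gaussian law.\<close>

definition gaussian_rv :: "'a measure \<Rightarrow> ('a \<Rightarrow> real) \<Rightarrow> bool" where
  "gaussian_rv M X \<longleftrightarrow> X \<in> borel_measurable M \<and>
     ((\<exists>\<mu>. AE \<omega> in M. X \<omega> = \<mu>) \<or>
      (\<exists>\<mu> \<sigma>. \<sigma> > 0 \<and> distributed M lborel X (normal_density \<mu> \<sigma>)))"

text \<open>Joint Gaussianity of the finite-dimensional marginals, expressed through linear combinations.\<close>

definition gaussian_process :: "'a measure \<Rightarrow> real set \<Rightarrow> (real \<Rightarrow> 'a \<Rightarrow> real) \<Rightarrow> bool" where
  "gaussian_process M I X \<longleftrightarrow>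
     (\<forall>J c. finite J \<and> J \<subseteq> I \<longrightarrow> gaussian_rv M (\<lambda>\<omega>. \<Sum>t\<in>J. c t * X t \<omega>))"

text \<open>For \<open>H > 0\<close> the convention \<open>0 powr a = 0\<close> gives the usual value of the covariance on
  the axes and on the diagonal.\<close>

definition continuous_fBm :: "'a measure \<Rightarrow> real \<Rightarrow> (real \<Rightarrow> 'a \<Rightarrow> real) \<Rightarrow> bool" where
  "continuous_fBm M H W \<longleftrightarrow>
     gaussian_process M {0..1} W \<and>
     (\<forall>t\<in>{0..1}. prob_space.expectation M (W t) = 0) \<and>
     (\<forall>s\<in>{0..1}. \<forall>t\<in>{0..1}.
        prob_space.expectation M (\<lambda>\<omega>. W s \<omega> * W t \<omega>) =
          (s powr (2 * H) + t powr (2 * H) - \<bar>t - s\<bar> powr (2 * H)) / 2) \<and>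
     (\<forall>\<omega>\<in>space M. continuous_on {0..1} (\<lambda>t. W t \<omega>))"

definition holder_on :: "real \<Rightarrow> real set \<Rightarrow> (real \<Rightarrow> real) \<Rightarrow> bool" where
  "holder_on \<tau> S f \<longleftrightarrow> (\<exists>C. \<forall>x\<in>S. \<forall>y\<in>S. \<bar>f x - f y\<bar> \<le> C * \<bar>x - y\<bar> powr \<tau>)"

definition fractional_bridge :: "(real \<Rightarrow> real) \<Rightarrow> (real \<Rightarrow> 'a \<Rightarrow> real) \<Rightarrow> real \<Rightarrow> 'a \<Rightarrow> real" where
  "fractional_bridge \<kappa> W u \<omega> = W u \<omega> - \<kappa> u * W 1 \<omega>"

definition wiener_weierstrass_bridge ::
    "real \<Rightarrow> nat \<Rightarrow> (real \<Rightarrow> real) \<Rightarrow> (real \<Rightarrow> 'a \<Rightarrow> real) \<Rightarrow> real \<Rightarrow> 'a \<Rightarrow> real" where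
  "wiener_weierstrass_bridge \<alpha> b \<kappa> W t \<omega> =
     (\<Sum>n. \<alpha> ^ n * fractional_bridge \<kappa> W (frac (real b ^ n * t)) \<omega>)"

definition roughness_exponent :: "real \<Rightarrow> nat \<Rightarrow> real" where
  "roughness_exponent \<alpha> b = min 1 (- log (real b) \<alpha>)"

definition orbit_avoiding_set :: "nat \<Rightarrow> nat \<Rightarrow> real set" where
  "orbit_avoiding_set b N =
     {x \<in> {0..1}. \<forall>k::nat. frac (real b ^ k * x) \<in> {1 / real b ^ N .. 1 - 1 / real b ^ N}}"

end

(* The variance of a linear functional of W_H is its squared norm in the frequency space with weight
   |xi|^(-1-2H). By Cauchy-Schwarz against the weights |xi|^(-2) and |xi|^(2H-3) it dominates the
   square of the value of the functional on any fixed piecewise linear function phi with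
   phi(0) = 0. Take for phi a trapezoid supported in one b-adic interval of level q + 1, equal to 1
   on its part that the orbits of T_N can visit. Since phi(1) = 0 the term with kappa disappears,
   and Y(t) - Y(s) is tested against the occurrences of a single digit word of length q + 1:

     sum_n alpha^n (1[word occurs in t at n] - 1[word occurs in s at n]).

   Let m be the first place where the digits of s and t differ, and choose as word the digits of t
   (or of s) at the places m - q, ..., m. The sum then starts with alpha^(m-q), and it can be spoilt
   only if the word recurs in the other expansion after a short shift. This cannot happen for both
   choices, because their common prefix would have two short periods and these determine the next
   letter. So the variance is at least of the order alpha^(2m) = b^(-2Km). *)
theory Submission
  imports Defs
begin

section \<open>Frequency representation of the fractional Brownian covariance\<close>

text \<open>Up to a constant this is the spectral density of fractional Brownian motion with
  \<open>g = 2 * H\<close>, kept only on the positive half-line because the functions integrated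
  against it are even.\<close>

definition frequency_weight :: "real \<Rightarrow> real \<Rightarrow> real" where
  "frequency_weight g \<xi> = indicator {0<..} \<xi> * \<xi> powr (-1 - g)"

definition frequency_constant :: "real \<Rightarrow> real" where
  "frequency_constant g = (LINT \<xi>|lborel. frequency_weight g \<xi> * (1 - cos \<xi>))"

text \<open>With \<open>g = 2 * H\<close> this is the covariance in \<open>continuous_fBm\<close>;
  \<open>g = 1\<close> is Brownian motion, and \<open>2 - g\<close> is the dual index in the
  Cauchy-Schwarz argument.\<close>

definition fbm_covariance :: "real \<Rightarrow> real \<Rightarrow> real \<Rightarrow> real" where
  "fbm_covariance g s t = (\<bar>s\<bar> powr g + \<bar>t\<bar> powr g - \<bar>t - s\<bar> powr g) / 2"

lemma measurable_frequency_weight [measurable]: "frequency_weight g \<in> borel_measurable borel"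
  unfolding frequency_weight_def by measurable

lemma integrable_of_power_bounds:
  fixes f :: "real \<Rightarrow> real"
  assumes [measurable]: "f \<in> borel_measurable borel" and "a > -1" and "b < -1"
    and near: "\<And>x. 0 < x \<Longrightarrow> x \<le> 1 \<Longrightarrow> \<bar>f x\<bar> \<le> C * x powr a"
    and far: "\<And>x. 1 \<le> x \<Longrightarrow> \<bar>f x\<bar> \<le> C * x powr b"
  shows "integrable lborel (\<lambda>x. indicator {0<..} x * f x)"
proof -
  have "(\<lambda>x. x powr a) absolutely_integrable_on {0..1}"
    using has_integral_powr_from_0[OF assms(2), of 1]
    by (intro nonnegative_absolutely_integrable_1) (auto simp: integrable_on_def)
  then have "integrable lborel (\<lambda>x. indicator {0..1} x * x powr a)"
    by (simp add: set_integrable_def integrable_completion)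
  moreover have "(\<lambda>x. x powr b) absolutely_integrable_on {1..}"
    using has_integral_powr_to_inf[OF assms(3), of 1]
    by (intro nonnegative_absolutely_integrable_1) (auto simp: integrable_on_def)
  then have "integrable lborel (\<lambda>x. indicator {1..} x * x powr b)"
    by (simp add: set_integrable_def integrable_completion)
  ultimately have "integrable lborel (\<lambda>x. C * (indicator {0..1} x * x powr a + indicator {1..} x * x powr b))"
    by (intro integrable_mult_right Bochner_Integration.integrable_add)
  then show ?thesis
  proof (rule Bochner_Integration.integrable_bound)
    have "C \<ge> 0" using near[of 1] by simp
    then show "AE x in lborel. norm (indicator {0<..} x * f x)
        \<le> norm (C * (indicator {0..1} x * x powr a + indicator {1..} x * x powr b))"
      using near far by (intro AE_I2) (force simp: indicator_def abs_mult)
  qed simp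
qed

lemma one_minus_cos_le_square: "1 - cos (x::real) \<le> x\<^sup>2 / 2"
proof -
  have "1 - cos x = 2 * (sin (x/2))\<^sup>2"
    using cos_double_sin[of "x/2"] by simp
  moreover have "(sin (x/2))\<^sup>2 \<le> (x/2)\<^sup>2"
    using abs_sin_x_le_abs_x[of "x/2"] by (metis abs_le_square_iff)
  ultimately show ?thesis by (simp add: power_divide)
qed

lemma integrable_frequency_weight:
  assumes "0 < g" "g < 2"
  shows "integrable lborel (\<lambda>\<xi>. frequency_weight g \<xi> * (1 - cos \<xi>))"
proof -
  have "integrable lborel (\<lambda>\<xi>. indicator {0<..} \<xi> * (\<xi> powr (-1 - g) * (1 - cos \<xi>)))"
  \<comment> \<open>Near 0 the factor \<open>1 - cos x\<close> is of order \<open>x\<^sup>2\<close>,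
    which leaves the exponent \<open>1 - g > -1\<close>; at infinity it is at most 2 and the
    exponent is \<open>-1 - g < -1\<close>. The two ends of the range of \<open>g\<close> enter
    here.\<close>
  proof (rule integrable_of_power_bounds[where a = "1 - g" and b = "-1 - g" and C = 2])
    fix x :: real assume x: "0 < x" "x \<le> 1"
    have "x powr (-1 - g) * (1 - cos x) \<le> x powr (-1 - g) * (x\<^sup>2)"
      using one_minus_cos_le_square[of x] zero_le_power2[of x] by (intro mult_left_mono powr_ge_zero) linarith
    also have "\<dots> = x powr (1 - g)"
      using x by (simp flip: powr_numeral add: powr_add[symmetric])
    also have "\<dots> \<le> 2 * x powr (1 - g)" by simp
    finally show "\<bar>x powr (-1 - g) * (1 - cos x)\<bar> \<le> 2 * x powr (1 - g)"
      by (simp add: abs_mult)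
  next
    fix x :: real assume x: "1 \<le> x"
    have "1 - cos x \<le> 2" using cos_ge_minus_one[of x] by linarith
    then show "\<bar>x powr (-1 - g) * (1 - cos x)\<bar> \<le> 2 * x powr (-1 - g)"
      by (simp add: abs_mult mult.commute mult_right_mono)
  qed (use assms in auto)
  then show ?thesis by (simp add: frequency_weight_def mult.assoc)
qed

lemma frequency_constant_pos:
  assumes "0 < g" "g < 2"
  shows "frequency_constant g > 0"
proof -
  \<comment> \<open>Product of the lower bounds of both factors on \<open>{1..2}\<close>, an
    interval inside \<open>{0..pi}\<close>, where \<open>cos\<close> decreases.\<close>
  define c where "c = 2 powr (-1 - g) * (1 - cos 1)"
  have "cos 1 < (1::real)" using cos_monotone_0_pi[of 0 1] pi_gt3 by simp
  then have "c > 0" by (simp add: c_def)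
  have "c = (LINT \<xi>|lborel. c * indicator {1..2::real} \<xi>)" by simp
  also have "\<dots> \<le> frequency_constant g"
    unfolding frequency_constant_def
  proof (rule integral_mono)
    show "integrable lborel (\<lambda>\<xi>. c * indicator {1..2::real} \<xi>)" by simp
    show "integrable lborel (\<lambda>\<xi>. frequency_weight g \<xi> * (1 - cos \<xi>))"
      using integrable_frequency_weight assms .
    fix x :: real
    show "c * indicator {1..2} x \<le> frequency_weight g x * (1 - cos x)"
    proof (cases "x \<in> {1..2}")
      case True
      then have "cos x \<le> cos 1" using cos_monotone_0_pi_le[of 1 x] pi_gt3 by simp
      moreover have "2 powr (-1 - g) \<le> x powr (-1 - g)"
        using True assms by (intro powr_mono2') auto
      ultimately have "c \<le> x powr (-1 - g) * (1 - cos x)"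
        unfolding c_def by (intro mult_mono) auto
      then show ?thesis using True by (simp add: frequency_weight_def)
    qed (simp add: frequency_weight_def)
  qed
  finally show ?thesis using \<open>c > 0\<close> by simp
qed

text \<open>Substitute \<open>\<bar>x\<bar> * \<xi>\<close> for the variable: the weight is
  homogeneous of degree \<open>-1 - g\<close> and the Jacobian supplies the remaining power. At
  \<open>x = 0\<close> both sides vanish.\<close>

lemma has_integral_frequency_scaled:
  assumes "0 < g" "g < 2"
  shows "has_bochner_integral lborel (\<lambda>\<xi>. frequency_weight g \<xi> * (1 - cos (x * \<xi>)))
    (frequency_constant g * \<bar>x\<bar> powr g)"
proof (cases "x = 0")
  case False
  define y where "y = \<bar>x\<bar>"
  have y: "y > 0" using False by (simp add: y_def)
  let ?f = "\<lambda>\<xi>. frequency_weight g \<xi> * (1 - cos \<xi>)"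
  have "has_bochner_integral lborel ?f (frequency_constant g)"
    using integrable_frequency_weight[OF assms]
    by (simp add: has_bochner_integral_iff frequency_constant_def)
  then have "has_bochner_integral lborel (\<lambda>\<xi>. ?f (0 + y * \<xi>)) (frequency_constant g /\<^sub>R \<bar>y\<bar>)"
    using y by (subst (asm) lborel_has_bochner_integral_real_affine_iff[of y _ _ 0]) auto
  then have "has_bochner_integral lborel (\<lambda>\<xi>. y powr (1 + g) * ?f (y * \<xi>))
      (y powr (1 + g) * (frequency_constant g /\<^sub>R \<bar>y\<bar>))"
    by (intro has_bochner_integral_mult_right) simp
  moreover have "y powr (1 + g) * ?f (y * \<xi>) = frequency_weight g \<xi> * (1 - cos (x * \<xi>))" for \<xi>
  proof (cases "\<xi> > 0")
    case True
    have "cos (y * \<xi>) = cos (x * \<xi>)" unfolding y_def by (cases "x \<ge> 0") auto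
    moreover have "y powr (1 + g) * (y * \<xi>) powr (-1 - g) = \<xi> powr (-1 - g)"
      using True y by (simp add: powr_mult powr_add[symmetric] flip: mult.assoc)
    ultimately show ?thesis using True y by (simp add: frequency_weight_def flip: mult.assoc)
  qed (use y in \<open>simp add: frequency_weight_def zero_less_mult_iff\<close>)
  moreover have "y powr (1 + g) * (frequency_constant g /\<^sub>R \<bar>y\<bar>) = frequency_constant g * \<bar>x\<bar> powr g"
    using y by (simp add: powr_add y_def[symmetric] field_simps)
  ultimately show ?thesis by (simp only:)
qed (simp add: has_bochner_integral_zero)

text \<open>The integrand is the weight times the real part of \<open>F\<close> times the conjugate
  of \<open>G\<close>, where \<open>F\<close> and \<open>G\<close> are the combinations of 1 - exp(i
  p \<xi>) with coefficients \<open>c\<close> and \<open>d\<close>. Termwise it equals \<open>(1 -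
  cos (p * \<xi>)) + (1 - cos (a * \<xi>)) - (1 - cos ((a - p) * \<xi>))\<close>, and each piece is
  integrated by the scaling formula.\<close>

lemma has_integral_frequency_product:
  assumes "0 < g" "g < 2"
  shows "has_bochner_integral lborel
    (\<lambda>\<xi>. frequency_weight g \<xi> *
      ((\<Sum>i\<in>I. c i * (1 - cos (p i * \<xi>))) * (\<Sum>j\<in>J. d j * (1 - cos (a j * \<xi>)))
       + (\<Sum>i\<in>I. c i * sin (p i * \<xi>)) * (\<Sum>j\<in>J. d j * sin (a j * \<xi>))))
    (2 * frequency_constant g * (\<Sum>i\<in>I. \<Sum>j\<in>J. c i * d j * fbm_covariance g (p i) (a j)))"
proof -
  let ?h = "\<lambda>x \<xi>. frequency_weight g \<xi> * (1 - cos (x * \<xi>))"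
  have "has_bochner_integral lborel
      (\<lambda>\<xi>. \<Sum>i\<in>I. \<Sum>j\<in>J. c i * d j * (?h (p i) \<xi> + ?h (a j) \<xi> - ?h (a j - p i) \<xi>))
      (\<Sum>i\<in>I. \<Sum>j\<in>J. c i * d j * (frequency_constant g * \<bar>p i\<bar> powr g
        + frequency_constant g * \<bar>a j\<bar> powr g - frequency_constant g * \<bar>a j - p i\<bar> powr g))"
    by (intro has_bochner_integral_sum has_bochner_integral_mult_right has_bochner_integral_add
        has_bochner_integral_diff has_integral_frequency_scaled assms)
  moreover have "(\<Sum>i\<in>I. \<Sum>j\<in>J. c i * d j * (?h (p i) \<xi> + ?h (a j) \<xi> - ?h (a j - p i) \<xi>))
    = frequency_weight g \<xi> *
      ((\<Sum>i\<in>I. c i * (1 - cos (p i * \<xi>))) * (\<Sum>j\<in>J. d j * (1 - cos (a j * \<xi>)))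
       + (\<Sum>i\<in>I. c i * sin (p i * \<xi>)) * (\<Sum>j\<in>J. d j * sin (a j * \<xi>)))" for \<xi>
    unfolding sum_product sum.distrib[symmetric]
    unfolding sum_distrib_left
    by (intro sum.cong refl) (simp add: left_diff_distrib cos_diff algebra_simps)
  moreover have "(\<Sum>i\<in>I. \<Sum>j\<in>J. c i * d j * (frequency_constant g * \<bar>p i\<bar> powr g
        + frequency_constant g * \<bar>a j\<bar> powr g - frequency_constant g * \<bar>a j - p i\<bar> powr g))
     = 2 * frequency_constant g * (\<Sum>i\<in>I. \<Sum>j\<in>J. c i * d j * fbm_covariance g (p i) (a j))"
    unfolding sum_distrib_left
    by (intro sum.cong refl) (simp add: fbm_covariance_def algebra_simps)
  ultimately show ?thesis by simp
qed

section \<open>Lower bound for the variance of a linear functional\<close>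

text \<open>Cauchy-Schwarz in frequency space: the weight for index 1 is the geometric mean of those
  for \<open>g\<close> and \<open>2 - g\<close>. The constant depends only on \<open>g\<close> and
  the fixed functional given by \<open>J\<close>, \<open>d\<close>, \<open>a\<close>; its uniformity
  in \<open>I\<close>, \<open>c\<close>, \<open>p\<close> later permits a passage to infinite
  series.\<close>

lemma fbm_covariance_dominates_square:
  fixes d a :: "'j \<Rightarrow> real"
  assumes g: "0 < g" "g < 2"
  shows "\<exists>k>0. \<forall>(I::'i set) c p.
    k * (\<Sum>i\<in>I. c i * (\<Sum>j\<in>J. d j * fbm_covariance 1 (p i) (a j)))\<^sup>2
      \<le> (\<Sum>i\<in>I. \<Sum>j\<in>I. c i * c j * fbm_covariance g (p i) (p j))"
proof -
  define E where "E = (\<Sum>i\<in>J. \<Sum>j\<in>J. d i * d j * fbm_covariance (2 - g) (a i) (a j))"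
  \<comment> \<open>\<open>E\<close> is, up to a factor, the squared norm of the fixed functional
    for the dual weight. Taking \<open>\<bar>E\<bar> + 1\<close> makes \<open>Q\<close> a positive
    upper bound that can be divided by.\<close>
  define Q where "Q = frequency_constant (2 - g) * (\<bar>E\<bar> + 1)"
  have pos: "frequency_constant g > 0" "frequency_constant 1 > 0" "frequency_constant (2 - g) > 0"
    using frequency_constant_pos g by auto
  then have Q: "Q > 0" by (simp add: Q_def add_nonneg_pos)
  have "(frequency_constant 1)\<^sup>2 / (Q * frequency_constant g) *
      (\<Sum>i\<in>I. c i * (\<Sum>j\<in>J. d j * fbm_covariance 1 (p i) (a j)))\<^sup>2
      \<le> (\<Sum>i\<in>I. \<Sum>j\<in>I. c i * c j * fbm_covariance g (p i) (p j))"
    for I :: "'i set" and c p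
  proof -
    define S where "S = (\<Sum>i\<in>I. c i * (\<Sum>j\<in>J. d j * fbm_covariance 1 (p i) (a j)))"
    define V where "V = (\<Sum>i\<in>I. \<Sum>j\<in>I. c i * c j * fbm_covariance g (p i) (p j))"
    \<comment> \<open>The maximiser of
      \<open>2 * lam * (frequency_constant 1 * S) - lam\<^sup>2 * Q\<close>, so that the integrated
      AM-GM inequality becomes Cauchy-Schwarz.\<close>
    define lam where "lam = frequency_constant 1 * S / Q"
    define A1 where "A1 = (\<lambda>\<xi>. \<Sum>i\<in>I. c i * (1 - cos (p i * \<xi>)))"
    define A2 where "A2 = (\<lambda>\<xi>. \<Sum>i\<in>I. c i * sin (p i * \<xi>))"
    define D1 where "D1 = (\<lambda>\<xi>. \<Sum>j\<in>J. d j * (1 - cos (a j * \<xi>)))"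
    define D2 where "D2 = (\<lambda>\<xi>. \<Sum>j\<in>J. d j * sin (a j * \<xi>))"
    have iV: "has_bochner_integral lborel
        (\<lambda>\<xi>. frequency_weight g \<xi> * (A1 \<xi> * A1 \<xi> + A2 \<xi> * A2 \<xi>)) (2 * frequency_constant g * V)"
      unfolding A1_def A2_def V_def by (rule has_integral_frequency_product[OF g])
    have iE: "has_bochner_integral lborel
        (\<lambda>\<xi>. frequency_weight (2 - g) \<xi> * (D1 \<xi> * D1 \<xi> + D2 \<xi> * D2 \<xi>))
        (2 * frequency_constant (2 - g) * E)"
      unfolding D1_def D2_def E_def by (rule has_integral_frequency_product) (use g in auto)
    have iS: "has_bochner_integral lborel
        (\<lambda>\<xi>. frequency_weight 1 \<xi> * (A1 \<xi> * D1 \<xi> + A2 \<xi> * D2 \<xi>)) (2 * frequency_constant 1 * S)"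
    proof -
      have "S = (\<Sum>i\<in>I. \<Sum>j\<in>J. c i * d j * fbm_covariance 1 (p i) (a j))"
        by (simp add: S_def sum_distrib_left mult.assoc)
      then show ?thesis
        using has_integral_frequency_product[of 1 c p I d a J]
        by (simp add: A1_def A2_def D1_def D2_def)
    qed
    have "2 * lam * (2 * frequency_constant 1 * S)
        = (LINT \<xi>|lborel. 2 * lam * (frequency_weight 1 \<xi> * (A1 \<xi> * D1 \<xi> + A2 \<xi> * D2 \<xi>)))"
      using has_bochner_integral_mult_right[OF iS, of "2 * lam"]
      by (simp only: has_bochner_integral_iff)
    also have "\<dots> \<le> (LINT \<xi>|lborel. frequency_weight g \<xi> * (A1 \<xi> * A1 \<xi> + A2 \<xi> * A2 \<xi>)
        + lam\<^sup>2 * (frequency_weight (2 - g) \<xi> * (D1 \<xi> * D1 \<xi> + D2 \<xi> * D2 \<xi>)))"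
    proof (rule integral_mono)
      fix \<xi> :: real
      define u v where "u = \<xi> powr ((-1 - g) / 2)" and "v = \<xi> powr ((-1 - (2 - g)) / 2)"
      show "2 * lam * (frequency_weight 1 \<xi> * (A1 \<xi> * D1 \<xi> + A2 \<xi> * D2 \<xi>))
        \<le> frequency_weight g \<xi> * (A1 \<xi> * A1 \<xi> + A2 \<xi> * A2 \<xi>)
        + lam\<^sup>2 * (frequency_weight (2 - g) \<xi> * (D1 \<xi> * D1 \<xi> + D2 \<xi> * D2 \<xi>))"
      proof (cases "\<xi> > 0")
        case True
        have "frequency_weight g \<xi> = u * u" "frequency_weight (2 - g) \<xi> = v * v"
            "frequency_weight 1 \<xi> = u * v"
          using True unfolding u_def v_def powr_add[symmetric] field_sum_of_halves
          by (simp_all add: frequency_weight_def field_simps)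
        moreover \<comment> \<open>AM-GM, with the weight \<open>\<xi> powr -2\<close> split as the product of the weights for \<open>g\<close> and \<open>2 - g\<close>\<close>
        have "0 \<le> (u * A1 \<xi> - lam * v * D1 \<xi>)\<^sup>2 + (u * A2 \<xi> - lam * v * D2 \<xi>)\<^sup>2" by simp
        ultimately show ?thesis by (simp add: power2_eq_square algebra_simps)
      qed (simp add: frequency_weight_def)
    qed (use has_bochner_integral_mult_right[OF iS, of "2 * lam"]
          has_bochner_integral_add[OF iV has_bochner_integral_mult_right[OF iE, of "lam\<^sup>2"]]
        in \<open>auto simp: has_bochner_integral_iff\<close>)
    also have "\<dots> = 2 * frequency_constant g * V + lam\<^sup>2 * (2 * frequency_constant (2 - g) * E)"
      using has_bochner_integral_add[OF iV has_bochner_integral_mult_right[OF iE, of "lam\<^sup>2"]]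
      by (simp add: has_bochner_integral_iff)
    also have "lam\<^sup>2 * (2 * frequency_constant (2 - g) * E) \<le> lam\<^sup>2 * (2 * Q)"
      using pos by (intro mult_left_mono) (auto simp: Q_def)
    finally have "2 * lam * (frequency_constant 1 * S) - lam\<^sup>2 * Q \<le> frequency_constant g * V"
      by simp
    moreover have "2 * lam * (frequency_constant 1 * S) - lam\<^sup>2 * Q = (frequency_constant 1 * S)\<^sup>2 / Q"
      using Q by (simp add: lam_def power2_eq_square field_simps)
    ultimately have "(frequency_constant 1 * S)\<^sup>2 / Q \<le> frequency_constant g * V" by simp
    then have "(frequency_constant 1)\<^sup>2 / (Q * frequency_constant g) * S\<^sup>2 \<le> V"
      using Q pos by (simp add: field_simps power_mult_distrib)
    then show ?thesis by (simp add: S_def V_def)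
  qed
  moreover have "(frequency_constant 1)\<^sup>2 / (Q * frequency_constant g) > 0"
    using Q pos by simp
  ultimately show ?thesis by blast
qed

lemma fbm_covariance_1: "0 \<le> s \<Longrightarrow> 0 \<le> t \<Longrightarrow> fbm_covariance 1 s t = min s t"
  by (auto simp: fbm_covariance_def abs_if min_def)

text \<open>A combination of Brownian covariances \<open>min s (a j)\<close> is piecewise linear
  with kinks at the points \<open>a j\<close>. Slope changes of size \<open>1 / h\<close> at
  \<open>l\<close>, \<open>l + h\<close>, \<open>r - h\<close>, \<open>r\<close> produce a
  trapezoid, and \<open>l + 2 * h \<le> r\<close> keeps its plateau nonempty.\<close>

lemma fbm_covariance_dominates_bump:
  fixes l r h g :: real
  assumes "0 < g" "g < 2" and "0 \<le> l" "0 < h" "l + 2 * h \<le> r" "r \<le> 1"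
  shows "\<exists>\<phi> k. k > 0 \<and> \<phi> 1 = 0 \<and> (\<forall>s\<in>{l + h..r - h}. \<phi> s = 1) \<and>
    (\<forall>s\<in>{0..1}. s \<le> l \<or> r \<le> s \<longrightarrow> \<phi> s = 0) \<and>
    (\<forall>(I::'i set) c p. p ` I \<subseteq> {0..1} \<longrightarrow>
      k * (\<Sum>i\<in>I. c i * \<phi> (p i))\<^sup>2 \<le> (\<Sum>i\<in>I. \<Sum>j\<in>I. c i * c j * fbm_covariance g (p i) (p j)))"
proof -
  define d where "d = (!) [1 / h, - 1 / h, 1 / h, - 1 / h]"
  define a where "a = (!) [l + h, l, r - h, r]"
  define \<phi> where "\<phi> s = (min s (l + h) - min s l + min s (r - h) - min s r) / h" for s
  have \<phi>: "(\<Sum>j<4. d j * fbm_covariance 1 s (a j)) = \<phi> s" if "s \<in> {0..1}" for s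
    using that assms
    by (simp add: eval_nat_numeral d_def a_def fbm_covariance_1 \<phi>_def diff_divide_distrib add_divide_distrib)
  obtain k where k: "k > 0" "\<And>(I::'i set) c p.
      k * (\<Sum>i\<in>I. c i * (\<Sum>j<4. d j * fbm_covariance 1 (p i) (a j)))\<^sup>2
        \<le> (\<Sum>i\<in>I. \<Sum>j\<in>I. c i * c j * fbm_covariance g (p i) (p j))"
    using fbm_covariance_dominates_square[OF assms(1,2), where J = "{..<4::nat}" and d = d and a = a] by blast
  have "k * (\<Sum>i\<in>I. c i * \<phi> (p i))\<^sup>2 \<le> (\<Sum>i\<in>I. \<Sum>j\<in>I. c i * c j * fbm_covariance g (p i) (p j))"
    if "p ` I \<subseteq> {0..1}" for I :: "'i set" and c p
  proof -
    have "(\<Sum>i\<in>I. c i * \<phi> (p i)) = (\<Sum>i\<in>I. c i * (\<Sum>j<4. d j * fbm_covariance 1 (p i) (a j)))"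
      using that \<phi> by (intro sum.cong) auto
    then show ?thesis using k(2)[of c p I] by simp
  qed
  moreover have "\<phi> 1 = 0" "\<forall>s\<in>{l + h..r - h}. \<phi> s = 1" "\<forall>s\<in>{0..1}. s \<le> l \<or> r \<le> s \<longrightarrow> \<phi> s = 0"
    using assms by (auto simp: \<phi>_def min_def)
  ultimately show ?thesis using k(1) by blast
qed

section \<open>Base-\<open>b\<close> digit words, their recurrence, and series of
  occurrences\<close>

text \<open>The \<open>L\<close> consecutive base-\<open>b\<close> digits from place
  \<open>n\<close> on, read as one integer with the most significant digit first. Place 0 is the
  first one after the point, and \<open>L = 1\<close> gives a single digit.\<close>

definition digit_word :: "nat \<Rightarrow> nat \<Rightarrow> nat \<Rightarrow> real \<Rightarrow> int" where
  "digit_word b L n x = \<lfloor>real b ^ L * frac (real b ^ n * x)\<rfloor>"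

lemma power_mult_frac:
  "real b ^ L * frac (real b ^ n * x) = real b ^ (n + L) * x - of_int (int b ^ L * \<lfloor>real b ^ n * x\<rfloor>)"
  by (simp add: frac_def power_add algebra_simps)

lemma digit_word_eq_diff:
  "digit_word b L n x = \<lfloor>real b ^ (n + L) * x\<rfloor> - int b ^ L * \<lfloor>real b ^ n * x\<rfloor>"
  unfolding digit_word_def power_mult_frac by (simp only: floor_diff_of_int)

lemma digit_word_Suc:
  "digit_word b (Suc L) n x = int b * digit_word b L n x + digit_word b 1 (n + L) x"
  by (simp add: digit_word_eq_diff algebra_simps)

lemma digit_range:
  assumes "0 < b"
  shows "0 \<le> digit_word b 1 n x" "digit_word b 1 n x < int b"
proof -
  have "real b * frac (real b ^ n * x) < real b" using assms frac_lt_1[of "real b ^ n * x"] by simp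
  then show "digit_word b 1 n x < int b" by (simp add: digit_word_def floor_less_iff)
qed (simp add: digit_word_def)

lemma digit_word_range:
  assumes "0 < b"
  shows "0 \<le> digit_word b L n x" "digit_word b L n x < int b ^ L"
proof -
  have "real b ^ L * frac (real b ^ n * x) < real b ^ L" using assms frac_lt_1[of "real b ^ n * x"] by simp
  then show "digit_word b L n x < int b ^ L" by (simp add: digit_word_def floor_less_iff)
qed (simp add: digit_word_def)

text \<open>The integer encoding loses nothing: reduction modulo \<open>b\<close> recovers the last
  digit, and induction handles the rest.\<close>

lemma digit_word_eq_iff:
  assumes "0 < b"
  shows "digit_word b L n x = digit_word b L m y \<longleftrightarrow>
    (\<forall>i<L. digit_word b 1 (n + i) x = digit_word b 1 (m + i) y)"
proof (induction L)
  case 0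
  then show ?case by (simp add: digit_word_def floor_eq_iff frac_lt_1)
next
  case (Suc L)
  let ?d = "digit_word b 1 (n + L) x" and ?e = "digit_word b 1 (m + L) y"
  have step: "int b * digit_word b L n x + ?d = int b * digit_word b L m y + ?e \<longleftrightarrow>
      digit_word b L n x = digit_word b L m y \<and> ?d = ?e"
    (is "?l \<longleftrightarrow> ?r")
  proof
    assume ?l
    then have "(int b * digit_word b L n x + ?d) mod int b = (int b * digit_word b L m y + ?e) mod int b"
      by simp
    then have "?d = ?e" using digit_range[OF assms] by simp
    with \<open>?l\<close> show ?r using assms by simp
  qed simp
  show ?case unfolding digit_word_Suc[of b L] step Suc by (auto simp: less_Suc_eq)
qed

text \<open>If both words recurred, their common prefix would have both shifts as periods, which forces
  equal last letters.\<close>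

lemma prefix_word_not_both_recurrent:
  fixes x y :: "nat \<Rightarrow> 'a"
  assumes eq: "\<And>i. i < q \<Longrightarrow> x i = y i" and neq: "x q \<noteq> y q" and R: "2 * R \<le> q"
  shows "(\<forall>r\<in>{1..R}. \<exists>i\<le>q. y (r + i) \<noteq> x i) \<or> (\<forall>r\<in>{1..R}. \<exists>i\<le>q. x (r + i) \<noteq> y i)"
proof (rule ccontr)
  assume "\<not> ?thesis"
  then obtain r r' where r: "1 \<le> r" "r \<le> R" "\<And>i. i \<le> q \<Longrightarrow> y (r + i) = x i"
    and r': "1 \<le> r'" "r' \<le> R" "\<And>i. i \<le> q \<Longrightarrow> x (r' + i) = y i" by auto
  \<comment> \<open>Go back from \<open>q\<close> by \<open>r'\<close> and then by \<open>r\<close>,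
    cross over inside the common prefix, and return in the opposite order. Here
    \<open>2 * R \<le> q\<close> prevents the subtractions from being truncated.\<close>
  have "x q = y (q - r')" using r'(3)[of "q - r'"] r' R by simp
  also have "\<dots> = x (q - r' - r)" using r(3)[of "q - r' - r"] r r' R by simp
  also have "\<dots> = y (q - r - r')" using eq[of "q - r' - r"] r r' R by (simp add: add.commute)
  also have "\<dots> = x (q - r)" using r'(3)[of "q - r - r'"] r r' R by simp
  also have "\<dots> = y q" using r(3)[of "q - r"] r R by simp
  finally show False using neq by simp
qed

text \<open>Up to index \<open>m + R\<close> nothing is negative and index \<open>m\<close>
  contributes \<open>\<alpha> ^ m\<close>. The tail beyond is at most
  \<open>\<alpha> ^ m * (\<alpha> ^ Suc R / (1 - \<alpha>))\<close>, which \<open>R\<close> makes at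
  most half of that.\<close>

lemma suminf_leading_term_bound:
  fixes e :: "nat \<Rightarrow> real"
  assumes \<alpha>: "0 < \<alpha>" "\<alpha> < 1" and R: "\<alpha> ^ Suc R / (1 - \<alpha>) \<le> 1 / 2"
    and bound: "\<And>n. \<bar>e n\<bar> \<le> 1" and lead: "e m = 1" and nonneg: "\<And>n. n \<le> m + R \<Longrightarrow> 0 \<le> e n"
  shows "\<alpha> ^ m / 2 \<le> (\<Sum>n. \<alpha> ^ n * e n)"
proof -
  define K where "K = m + Suc R"
  have geo: "(\<lambda>n. \<alpha> ^ (n + K)) sums (\<alpha> ^ K / (1 - \<alpha>))"
    using sums_mult[OF geometric_sums[of \<alpha>], of "\<alpha> ^ K"] \<alpha> by (simp add: power_add mult.commute)
  have b': "\<bar>\<alpha> ^ n * e n\<bar> \<le> \<alpha> ^ n" for n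
    using bound[of n] \<alpha> by (simp add: abs_mult mult_left_le)
  have summ: "summable (\<lambda>n. \<alpha> ^ n * e n)"
    by (rule summable_comparison_test'[of "\<lambda>n. \<alpha> ^ n" 0]) (use \<alpha> b' in \<open>auto simp: summable_geometric\<close>)
  have "\<alpha> ^ m = \<alpha> ^ m * e m" by (simp add: lead)
  also have "\<dots> \<le> (\<Sum>n<K. \<alpha> ^ n * e n)"
    by (rule member_le_sum) (use nonneg \<alpha> in \<open>auto simp: K_def\<close>)
  finally have 1: "\<alpha> ^ m \<le> (\<Sum>n<K. \<alpha> ^ n * e n)" .
  have "- (\<alpha> ^ K / (1 - \<alpha>)) = (\<Sum>n. - (\<alpha> ^ (n + K)))"
    using sums_minus[OF geo] by (simp add: sums_iff)
  also have "\<dots> \<le> (\<Sum>n. \<alpha> ^ (n + K) * e (n + K))"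
  proof (rule suminf_le)
    show "- (\<alpha> ^ (n + K)) \<le> \<alpha> ^ (n + K) * e (n + K)" for n using b'[of "n + K"] by linarith
    show "summable (\<lambda>n. - (\<alpha> ^ (n + K)))" using sums_minus[OF geo] by (simp add: sums_iff)
    show "summable (\<lambda>n. \<alpha> ^ (n + K) * e (n + K))" using summable_ignore_initial_segment[OF summ] .
  qed
  finally have 2: "- (\<alpha> ^ K / (1 - \<alpha>)) \<le> (\<Sum>n. \<alpha> ^ (n + K) * e (n + K))" .
  have "\<alpha> ^ K / (1 - \<alpha>) = \<alpha> ^ m * (\<alpha> ^ Suc R / (1 - \<alpha>))" by (simp add: K_def power_add)
  also have "\<dots> \<le> \<alpha> ^ m * (1 / 2)" using R \<alpha> by (intro mult_left_mono) auto
  finally show ?thesis using 1 2 suminf_split_initial_segment[OF summ, of K] by simp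
qed

section \<open>Orbits of points of \<open>T_N\<close> in \<open>b\<close>-adic cells\<close>

lemma frac_power_shift: "frac (real b ^ L * frac (real b ^ n * x)) = frac (real b ^ (n + L) * x)"
  unfolding power_mult_frac by (simp add: frac_def floor_diff_of_int del: of_int_mult of_int_power)

text \<open>\<open>L\<close> steps further along the orbit, the point keeps distance
  \<open>1 / real b ^ N\<close> from 0 and 1. Scaled back by \<open>real b ^ L\<close>, this is a
  margin between \<open>z\<close> and the ends of its cell.\<close>

lemma orbit_word_cell:
  fixes n :: nat
  assumes "x \<in> orbit_avoiding_set b N" "0 < b"
  defines "z \<equiv> frac (real b ^ n * x)"
  shows "digit_word b L n x = w \<Longrightarrow>
      z \<in> {of_int w / real b ^ L + (1 / real b ^ N) / real b ^ L ..
           (of_int w + 1) / real b ^ L - (1 / real b ^ N) / real b ^ L}"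
    and "digit_word b L n x \<noteq> w \<Longrightarrow> z \<le> of_int w / real b ^ L \<or> (of_int w + 1) / real b ^ L \<le> z"
proof -
  have fr: "frac (real b ^ L * z) \<in> {1 / real b ^ N .. 1 - 1 / real b ^ N}"
    using assms(1) unfolding z_def frac_power_shift orbit_avoiding_set_def by blast
  have B: "real b ^ L > 0" using assms by simp
  { assume "digit_word b L n x = w"
    then have "frac (real b ^ L * z) = real b ^ L * z - of_int w"
      by (simp add: digit_word_def z_def frac_def)
    then have "real b ^ L * z \<in> {of_int w + 1 / real b ^ N .. of_int w + 1 - 1 / real b ^ N}"
      using fr by auto
    then have "(of_int w + 1 / real b ^ N) / real b ^ L \<le> z"
        "z \<le> (of_int w + 1 - 1 / real b ^ N) / real b ^ L"
      using B by (simp_all add: pos_divide_le_eq pos_le_divide_eq mult.commute)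
    then show "z \<in> {of_int w / real b ^ L + (1 / real b ^ N) / real b ^ L ..
           (of_int w + 1) / real b ^ L - (1 / real b ^ N) / real b ^ L}"
      by (simp add: add_divide_distrib diff_divide_distrib) }
  { assume "digit_word b L n x \<noteq> w"
    then have "real b ^ L * z < of_int w \<or> of_int w + 1 \<le> real b ^ L * z"
      unfolding digit_word_def z_def by linarith
    then show "z \<le> of_int w / real b ^ L \<or> (of_int w + 1) / real b ^ L \<le> z"
      using B by (auto simp: pos_divide_le_eq pos_le_divide_eq mult.commute) }
qed

text \<open>Strict positivity keeps the evaluation points in the range required by
  \<open>fBm_integrable_product\<close>.\<close>

lemma orbit_frac_bounds:
  fixes n :: nat
  assumes "x \<in> orbit_avoiding_set b N" "0 < b"
  shows "0 < frac (real b ^ n * x)" "frac (real b ^ n * x) < 1"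
proof -
  have "1 / real b ^ N \<le> frac (real b ^ n * x)" using assms(1) by (auto simp: orbit_avoiding_set_def)
  moreover have "0 < 1 / real b ^ N" using assms(2) by simp
  ultimately show "0 < frac (real b ^ n * x)" by linarith
qed (rule frac_lt_1)

section \<open>Second moments of fractional Brownian motion and of the bridge series\<close>

text \<open>Cauchy-Schwarz with half of the geometric weight in each factor. The bound does not
  depend on \<open>L\<close>, so it can serve as majorant in dominated convergence.\<close>

lemma weighted_sum_square_le:
  fixes v :: "nat \<Rightarrow> real"
  assumes "0 < \<alpha>" "\<alpha> < 1" and summ: "summable (\<lambda>n. \<alpha> ^ n * (v n)\<^sup>2)"
  shows "(\<Sum>n<L. \<alpha> ^ n * v n)\<^sup>2 \<le> 1 / (1 - \<alpha>) * (\<Sum>n. \<alpha> ^ n * (v n)\<^sup>2)"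
proof -
  have "(\<Sum>n<L. sqrt (\<alpha> ^ n) * (sqrt (\<alpha> ^ n) * v n))\<^sup>2
      \<le> (\<Sum>n<L. (sqrt (\<alpha> ^ n))\<^sup>2) * (\<Sum>n<L. (sqrt (\<alpha> ^ n) * v n)\<^sup>2)"
    by (rule Cauchy_Schwarz_ineq_sum)
  then have "(\<Sum>n<L. \<alpha> ^ n * v n)\<^sup>2 \<le> (\<Sum>n<L. \<alpha> ^ n) * (\<Sum>n<L. \<alpha> ^ n * (v n)\<^sup>2)"
    using assms(1) by (simp add: power_mult_distrib flip: mult.assoc)
  also have "\<dots> \<le> 1 / (1 - \<alpha>) * (\<Sum>n. \<alpha> ^ n * (v n)\<^sup>2)"
  proof (intro mult_mono)
    have "(\<Sum>n<L. \<alpha> ^ n) \<le> (\<Sum>n. \<alpha> ^ n)"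
      using assms by (intro sum_le_suminf) (auto simp: summable_geometric)
    then show "(\<Sum>n<L. \<alpha> ^ n) \<le> 1 / (1 - \<alpha>)" using assms by (simp add: suminf_geometric)
    show "(\<Sum>n<L. \<alpha> ^ n * (v n)\<^sup>2) \<le> (\<Sum>n. \<alpha> ^ n * (v n)\<^sup>2)"
      using assms by (intro sum_le_suminf) auto
  qed (use assms in \<open>auto intro: sum_nonneg\<close>)
  finally show ?thesis .
qed

lemma fBm_measurable:
  assumes "continuous_fBm M H W" "t \<in> {0..1}"
  shows "W t \<in> borel_measurable M"
proof -
  have "gaussian_rv M (\<lambda>\<omega>. \<Sum>s\<in>{t}. 1 * W s \<omega>)"
    using assms unfolding continuous_fBm_def gaussian_process_def
    by (elim conjE allE[of _ "{t}"] allE[of _ "\<lambda>_. 1"] impE) simp_all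
  then show ?thesis by (simp add: gaussian_rv_def)
qed

lemma fBm_covariance:
  assumes "continuous_fBm M H W" "s \<in> {0..1}" "t \<in> {0..1}"
  shows "(\<integral>\<omega>. W s \<omega> * W t \<omega> \<partial>M) = fbm_covariance (2 * H) s t"
  using assms by (simp add: continuous_fBm_def fbm_covariance_def)

text \<open>The integral of a non-integrable function is 0 by convention, whereas the prescribed
  second moment at \<open>u > 0\<close> is \<open>u powr (2 * H)\<close>, which is positive. Hence
  the squares are integrable, and so are products; this is why 0 is left out of the range.\<close>

lemma fBm_integrable_product:
  assumes fbm: "continuous_fBm M H W" and s: "s \<in> {0<..1}" and t: "t \<in> {0<..1}"
  shows "integrable M (\<lambda>\<omega>. W s \<omega> * W t \<omega>)"
proof -
  have sq: "integrable M (\<lambda>\<omega>. W u \<omega> * W u \<omega>)" if "u \<in> {0<..1}" for u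
  proof (rule ccontr)
    assume "\<not> ?thesis"
    then have "fbm_covariance (2 * H) u u = 0"
      using fBm_covariance[OF fbm, of u u] that by (simp add: not_integrable_integral_eq)
    then show False using that by (simp add: fbm_covariance_def)
  qed
  have [measurable]: "W s \<in> borel_measurable M" "W t \<in> borel_measurable M"
    using fBm_measurable[OF fbm] s t by auto
  show ?thesis
  proof (rule Bochner_Integration.integrable_bound[OF Bochner_Integration.integrable_add[OF sq[OF s] sq[OF t]]])
    have "\<bar>a * b\<bar> \<le> a * a + b * b" for a b :: real
    proof -
      have "2 * \<bar>a * b\<bar> \<le> a * a + b * b"
        using sum_squares_bound[of "\<bar>a\<bar>" "\<bar>b\<bar>"] by (simp add: abs_mult power2_eq_square)
      then show ?thesis by linarith
    qed
    then show "AE \<omega> in M. norm (W s \<omega> * W t \<omega>) \<le> norm (W s \<omega> * W s \<omega> + W t \<omega> * W t \<omega>)"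
      by (intro AE_I2) (simp add: add_nonneg_nonneg)
  qed simp
qed

lemma fBm_second_moment_linear_combination:
  assumes fbm: "continuous_fBm M H W" and p: "p ` I \<subseteq> {0<..1}"
  shows "(\<integral>\<omega>. (\<Sum>i\<in>I. c i * W (p i) \<omega>)\<^sup>2 \<partial>M) =
      (\<Sum>i\<in>I. \<Sum>j\<in>I. c i * c j * fbm_covariance (2 * H) (p i) (p j))"
proof -
  have eq: "(\<Sum>i\<in>I. c i * W (p i) \<omega>)\<^sup>2
      = (\<Sum>i\<in>I. \<Sum>j\<in>I. c i * c j * (W (p i) \<omega> * W (p j) \<omega>))" for \<omega>
    unfolding power2_eq_square sum_product by (simp add: mult_ac)
  have int: "integrable M (\<lambda>\<omega>. c i * c j * (W (p i) \<omega> * W (p j) \<omega>))"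
    if "i \<in> I" "j \<in> I" for i j
    using that p by (intro integrable_mult_right fBm_integrable_product[OF fbm]) auto
  have "(\<integral>\<omega>. (\<Sum>i\<in>I. c i * W (p i) \<omega>)\<^sup>2 \<partial>M)
      = (\<Sum>i\<in>I. \<Sum>j\<in>I. \<integral>\<omega>. c i * c j * (W (p i) \<omega> * W (p j) \<omega>) \<partial>M)"
    unfolding eq using int
    by (subst Bochner_Integration.integral_sum)
      (auto intro!: Bochner_Integration.integral_sum sum.cong Bochner_Integration.integrable_sum)
  also have "\<dots> = (\<Sum>i\<in>I. \<Sum>j\<in>I. c i * c j * fbm_covariance (2 * H) (p i) (p j))"
  proof (intro sum.cong refl)
    fix i j assume "i \<in> I" "j \<in> I"
    then have "p i \<in> {0..1}" "p j \<in> {0..1}" using p by force+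
    then show "(\<integral>\<omega>. c i * c j * (W (p i) \<omega> * W (p j) \<omega>) \<partial>M)
        = c i * c j * fbm_covariance (2 * H) (p i) (p j)"
      using fBm_covariance[OF fbm] by simp
  qed
  finally show "(\<integral>\<omega>. (\<Sum>i\<in>I. c i * W (p i) \<omega>)\<^sup>2 \<partial>M) =
      (\<Sum>i\<in>I. \<Sum>j\<in>I. c i * c j * fbm_covariance (2 * H) (p i) (p j))" .
qed

text \<open>Partial sums are finite linear combinations of values of \<open>W\<close>, to which
  \<open>dom\<close> applies with one constant \<open>k\<close>. The inequality then passes to the
  limit, on the variance side by dominated convergence.\<close>

lemma bridge_series_variance_lower_bound:
  fixes M :: "'a measure" and x y :: "nat \<Rightarrow> real"
  assumes fbm: "continuous_fBm M H W" and H: "0 < H"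
    and \<kappa>: "\<kappa> ` {0..1} \<subseteq> {0..1}" and \<alpha>: "0 < \<alpha>" "\<alpha> < 1"
    and x: "\<And>n. x n \<in> {0<..1}" and y: "\<And>n. y n \<in> {0<..1}"
    and dom: "\<And>(I::(nat \<times> nat) set) c p. p ` I \<subseteq> {0..1} \<Longrightarrow>
      k * (\<Sum>i\<in>I. c i * \<phi> (p i))\<^sup>2 \<le> (\<Sum>i\<in>I. \<Sum>j\<in>I. c i * c j * fbm_covariance (2 * H) (p i) (p j))"
    and \<phi>1: "\<phi> 1 = 0" and \<phi>: "summable (\<lambda>n. \<alpha> ^ n * (\<phi> (x n) - \<phi> (y n)))"
  shows "k * (\<Sum>n. \<alpha> ^ n * (\<phi> (x n) - \<phi> (y n)))\<^sup>2 \<le>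
    (\<integral>\<omega>. \<bar>(\<Sum>n. \<alpha> ^ n * fractional_bridge \<kappa> W (x n) \<omega>)
          - (\<Sum>n. \<alpha> ^ n * fractional_bridge \<kappa> W (y n) \<omega>)\<bar>\<^sup>2 \<partial>M)"
proof -
  have \<kappa>01: "0 \<le> \<kappa> t" "\<kappa> t \<le> 1" if "t \<in> {0..1}" for t using \<kappa> that by force+
  have x': "x n \<in> {0..1}" and y': "y n \<in> {0..1}" for n using x[of n] y[of n] by auto
  have [measurable]: "W (x n) \<in> borel_measurable M" "W (y n) \<in> borel_measurable M"
      "W 1 \<in> borel_measurable M" for n
    using fBm_measurable[OF fbm] x' y' by auto
  define v where "v n \<omega> = fractional_bridge \<kappa> W (x n) \<omega> - fractional_bridge \<kappa> W (y n) \<omega>" for n \<omega>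
  have [measurable]: "v n \<in> borel_measurable M" for n
    unfolding v_def fractional_bridge_def by measurable
  define D where "D L \<omega> = (\<Sum>n<L. \<alpha> ^ n * v n \<omega>)" for L \<omega>
  have [measurable]: "D L \<in> borel_measurable M" for L unfolding D_def by measurable

  \<comment> \<open>The summand with index \<open>n\<close> evaluates \<open>W\<close> at
    \<open>x n\<close>, \<open>y n\<close> and 1; pairs \<open>(n, i)\<close> with
    \<open>i < 3\<close> turn \<open>D L\<close> into one linear combination. The point 1 carries
    the \<kappa>-correction, which \<open>\<phi> 1 = 0\<close> removes from the tested sum.\<close>
  define P where "P = (\<lambda>(n::nat, i::nat). if i = 0 then x n else if i = 1 then y n else 1)"
  define C where "C = (\<lambda>(n::nat, i::nat). \<alpha> ^ n *
    (if i = 0 then 1 else if i = 1 then - 1 else - (\<kappa> (x n) - \<kappa> (y n))))"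
  have P: "P z \<in> {0<..1}" for z using x y by (auto simp: P_def split: prod.splits)
  have split3: "(\<Sum>z\<in>{..<L} \<times> {..<3}. f z) = (\<Sum>n<L. f (n, 0) + f (n, 1) + f (n, 2))"
    for f :: "nat \<times> nat \<Rightarrow> real" and L
  proof -
    have "(\<Sum>z\<in>{..<L} \<times> {..<3}. f z) = (\<Sum>n<L. \<Sum>i<3. f (n, i))"
      by (simp add: sum.cartesian_product)
    then show ?thesis by (simp add: eval_nat_numeral)
  qed
  have le: "k * (\<Sum>n<L. \<alpha> ^ n * (\<phi> (x n) - \<phi> (y n)))\<^sup>2 \<le> (\<integral>\<omega>. (D L \<omega>)\<^sup>2 \<partial>M)" for L
  proof -
    let ?I = "{..<L} \<times> {..<3::nat}"
    have "(\<Sum>n<L. \<alpha> ^ n * (\<phi> (x n) - \<phi> (y n))) = (\<Sum>z\<in>?I. C z * \<phi> (P z))"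
      unfolding split3 by (simp add: C_def P_def \<phi>1 algebra_simps)
    moreover have "D L \<omega> = (\<Sum>z\<in>?I. C z * W (P z) \<omega>)" for \<omega>
      unfolding split3 by (simp add: D_def v_def fractional_bridge_def C_def P_def algebra_simps)
    moreover have "P ` ?I \<subseteq> {0<..1}" using P by blast
    moreover from this have "P ` ?I \<subseteq> {0..1}" by (rule order_trans) auto
    ultimately show ?thesis
      using dom[of P ?I C] fBm_second_moment_linear_combination[OF fbm, of P ?I C] by simp
  qed
  have lim1: "(\<lambda>L. k * (\<Sum>n<L. \<alpha> ^ n * (\<phi> (x n) - \<phi> (y n)))\<^sup>2)
      \<longlonglongrightarrow> k * (\<Sum>n. \<alpha> ^ n * (\<phi> (x n) - \<phi> (y n)))\<^sup>2"
    by (intro tendsto_intros summable_LIMSEQ \<phi>)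
  have lim2: "(\<lambda>L. \<integral>\<omega>. (D L \<omega>)\<^sup>2 \<partial>M) \<longlonglongrightarrow> (\<integral>\<omega>. (\<Sum>n. \<alpha> ^ n * v n \<omega>)\<^sup>2 \<partial>M)"
    and eq: "(\<integral>\<omega>. (\<Sum>n. \<alpha> ^ n * v n \<omega>)\<^sup>2 \<partial>M) =
      (\<integral>\<omega>. \<bar>(\<Sum>n. \<alpha> ^ n * fractional_bridge \<kappa> W (x n) \<omega>)
          - (\<Sum>n. \<alpha> ^ n * fractional_bridge \<kappa> W (y n) \<omega>)\<bar>\<^sup>2 \<partial>M)"
  proof -
    \<comment> \<open>Path continuity gives a bound \<open>B\<close> that depends on
      \<open>\<omega>\<close>: enough for pathwise convergence, while an integrable majorant is
      built separately from \<open>Z\<close>.\<close>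
    have pw: "\<exists>B. \<forall>t\<in>{0..1}. \<bar>fractional_bridge \<kappa> W t \<omega>\<bar> \<le> B" if "\<omega> \<in> space M" for \<omega>
    proof -
      have "continuous_on {0..1} (\<lambda>t. W t \<omega>)" using fbm that by (auto simp: continuous_fBm_def)
      then have "compact ((\<lambda>t. W t \<omega>) ` {0..1})" by (rule compact_continuous_image) simp
      then obtain B where B: "\<And>t. t \<in> {0..1} \<Longrightarrow> \<bar>W t \<omega>\<bar> \<le> B"
        by (force dest!: compact_imp_bounded simp: bounded_iff)
      have "\<bar>fractional_bridge \<kappa> W t \<omega>\<bar> \<le> 2 * B" if t: "t \<in> {0..1}" for t
      proof -
        have "\<bar>\<kappa> t * W 1 \<omega>\<bar> \<le> 1 * B"
          unfolding abs_mult using \<kappa>01[OF t] B[of 1] by (intro mult_mono) auto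
        then show ?thesis using B[OF t] unfolding fractional_bridge_def by linarith
      qed
      then show ?thesis by blast
    qed
    have summable_bounded: "summable (\<lambda>n. \<alpha> ^ n * a n)" if "\<And>n. \<bar>a n\<bar> \<le> B" for a :: "nat \<Rightarrow> real" and B
    proof (rule summable_comparison_test'[of "\<lambda>n. \<alpha> ^ n * B" 0])
      show "summable (\<lambda>n. \<alpha> ^ n * B)" using \<alpha> by (intro summable_mult2 summable_geometric) auto
      show "norm (\<alpha> ^ n * a n) \<le> \<alpha> ^ n * B" for n
        using that[of n] \<alpha> by (simp add: abs_mult)
    qed
    have sx: "summable (\<lambda>n. \<alpha> ^ n * fractional_bridge \<kappa> W (x n) \<omega>)"
      and sy: "summable (\<lambda>n. \<alpha> ^ n * fractional_bridge \<kappa> W (y n) \<omega>)"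
      and sv: "summable (\<lambda>n. \<alpha> ^ n * v n \<omega>)"
      and sv2: "summable (\<lambda>n. \<alpha> ^ n * (v n \<omega>)\<^sup>2)" if \<omega>: "\<omega> \<in> space M" for \<omega>
    proof -
      obtain B where B: "\<And>t. t \<in> {0..1} \<Longrightarrow> \<bar>fractional_bridge \<kappa> W t \<omega>\<bar> \<le> B"
        using pw[OF \<omega>] by blast
      have v: "\<bar>v n \<omega>\<bar> \<le> 2 * B" for n using B[OF x'[of n]] B[OF y'[of n]] unfolding v_def by linarith
      have "\<bar>(v n \<omega>)\<^sup>2\<bar> \<le> (2 * B)\<^sup>2" for n
        using power_mono[OF v[of n], of 2] by simp
      then show "summable (\<lambda>n. \<alpha> ^ n * (v n \<omega>)\<^sup>2)" by (rule summable_bounded)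
      show "summable (\<lambda>n. \<alpha> ^ n * v n \<omega>)" using v by (rule summable_bounded)
      show "summable (\<lambda>n. \<alpha> ^ n * fractional_bridge \<kappa> W (x n) \<omega>)"
        using B[OF x'] by (rule summable_bounded)
      show "summable (\<lambda>n. \<alpha> ^ n * fractional_bridge \<kappa> W (y n) \<omega>)"
        using B[OF y'] by (rule summable_bounded)
    qed
    show "(\<integral>\<omega>. (\<Sum>n. \<alpha> ^ n * v n \<omega>)\<^sup>2 \<partial>M) =
      (\<integral>\<omega>. \<bar>(\<Sum>n. \<alpha> ^ n * fractional_bridge \<kappa> W (x n) \<omega>)
          - (\<Sum>n. \<alpha> ^ n * fractional_bridge \<kappa> W (y n) \<omega>)\<bar>\<^sup>2 \<partial>M)"
      by (intro Bochner_Integration.integral_cong refl)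
        (simp add: v_def right_diff_distrib suminf_diff[OF sx sy])
    \<comment> \<open>From \<open>(a - b - c)\<^sup>2 \<le> 3 * (a\<^sup>2 + b\<^sup>2 +
      c\<^sup>2)\<close> and the fact that increments of \<kappa> are at most 1 in modulus. All
      variances are at most 1, so the expectation is at most 9 for every \<open>n\<close>.\<close>
    define Z where "Z n \<omega> = 3 * ((W (x n) \<omega>)\<^sup>2 + (W (y n) \<omega>)\<^sup>2 + (W 1 \<omega>)\<^sup>2)" for n \<omega>
    have v_le: "(v n \<omega>)\<^sup>2 \<le> Z n \<omega>" for n \<omega>
    proof -
      define e where "e = \<kappa> (x n) - \<kappa> (y n)"
      have "\<bar>e\<bar> \<le> 1" using \<kappa>01[OF x'[of n]] \<kappa>01[OF y'[of n]] by (simp add: e_def abs_le_iff)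
      then have "e\<^sup>2 * (W 1 \<omega>)\<^sup>2 \<le> 1 * (W 1 \<omega>)\<^sup>2"
        by (intro mult_right_mono) (auto simp: abs_square_le_1)
      moreover have "(a - b - c)\<^sup>2 \<le> 3 * (a\<^sup>2 + b\<^sup>2 + c\<^sup>2)" for a b c :: real
        using zero_le_power2[of "a + b"] zero_le_power2[of "a + c"] zero_le_power2[of "b - c"]
        by (simp add: power2_eq_square algebra_simps)
      from this[of "W (x n) \<omega>" "W (y n) \<omega>" "e * W 1 \<omega>"]
      have "(v n \<omega>)\<^sup>2 \<le> 3 * ((W (x n) \<omega>)\<^sup>2 + (W (y n) \<omega>)\<^sup>2 + (e * W 1 \<omega>)\<^sup>2)"
        by (simp add: v_def fractional_bridge_def e_def algebra_simps)
      ultimately show ?thesis by (simp add: Z_def power_mult_distrib)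
    qed
    have sq: "integrable M (\<lambda>\<omega>. (W t \<omega>)\<^sup>2)" "(\<integral>\<omega>. (W t \<omega>)\<^sup>2 \<partial>M) \<le> 1" if "t \<in> {0<..1}" for t
    proof -
      show "integrable M (\<lambda>\<omega>. (W t \<omega>)\<^sup>2)"
        using fBm_integrable_product[OF fbm that that] by (simp add: power2_eq_square)
      have "(\<integral>\<omega>. (W t \<omega>)\<^sup>2 \<partial>M) = t powr (2 * H)"
        using fBm_covariance[OF fbm, of t t] that by (simp add: power2_eq_square fbm_covariance_def)
      also have "\<dots> \<le> 1" using that H by (intro powr_le1) auto
      finally show "(\<integral>\<omega>. (W t \<omega>)\<^sup>2 \<partial>M) \<le> 1" .
    qed
    have iZ: "integrable M (Z n)" for n
      unfolding Z_def using x y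
      by (intro integrable_mult_right Bochner_Integration.integrable_add sq) auto
    have "(\<integral>\<omega>. Z n \<omega> \<partial>M) \<le> 9" for n
      unfolding Z_def using sq[OF x[of n]] sq[OF y[of n]] sq[of 1] by simp
    then have v9: "(\<integral>\<omega>. (v n \<omega>)\<^sup>2 \<partial>M) \<le> 9" and iv: "integrable M (\<lambda>\<omega>. (v n \<omega>)\<^sup>2)" for n
    proof -
      show iv: "integrable M (\<lambda>\<omega>. (v n \<omega>)\<^sup>2)"
        by (rule Bochner_Integration.integrable_bound[OF iZ[of n]])
          (use v_le[of n] in \<open>auto intro!: AE_I2 order_trans[OF _ abs_ge_self]\<close>)
      assume "\<And>n. (\<integral>\<omega>. Z n \<omega> \<partial>M) \<le> 9"
      then show "(\<integral>\<omega>. (v n \<omega>)\<^sup>2 \<partial>M) \<le> 9"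
        using integral_mono[OF iv iZ[of n] v_le] order_trans by blast
    qed
    \<comment> \<open>The majorant is integrable because the expectations of its terms are bounded
      by the geometric series with terms \<open>9 * \<alpha> ^ n\<close>.\<close>
    have "integrable M (\<lambda>\<omega>. \<Sum>n. \<alpha> ^ n * (v n \<omega>)\<^sup>2)"
    proof (rule integrable_suminf)
      show "integrable M (\<lambda>\<omega>. \<alpha> ^ n * (v n \<omega>)\<^sup>2)" for n using iv by simp
      show "AE \<omega> in M. summable (\<lambda>n. norm (\<alpha> ^ n * (v n \<omega>)\<^sup>2))"
        using sv2 \<alpha> by (intro AE_I2) simp
      have "summable (\<lambda>n. \<alpha> ^ n * (\<integral>\<omega>. (v n \<omega>)\<^sup>2 \<partial>M))"
        using v9 by (intro summable_bounded[of _ 9]) simp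
      then show "summable (\<lambda>n. \<integral>\<omega>. norm (\<alpha> ^ n * (v n \<omega>)\<^sup>2) \<partial>M)"
        using \<alpha> by simp
    qed
    then have "integrable M (\<lambda>\<omega>. 1 / (1 - \<alpha>) * (\<Sum>n. \<alpha> ^ n * (v n \<omega>)\<^sup>2))"
      by (rule integrable_mult_right)
    then show "(\<lambda>L. \<integral>\<omega>. (D L \<omega>)\<^sup>2 \<partial>M) \<longlonglongrightarrow> (\<integral>\<omega>. (\<Sum>n. \<alpha> ^ n * v n \<omega>)\<^sup>2 \<partial>M)"
    proof (rule integral_dominated_convergence[rotated 2])
      show "AE \<omega> in M. (\<lambda>L. (D L \<omega>)\<^sup>2) \<longlonglongrightarrow> (\<Sum>n. \<alpha> ^ n * v n \<omega>)\<^sup>2"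
        unfolding D_def by (intro AE_I2 tendsto_intros summable_LIMSEQ sv)
      show "AE \<omega> in M. norm ((D L \<omega>)\<^sup>2) \<le> 1 / (1 - \<alpha>) * (\<Sum>n. \<alpha> ^ n * (v n \<omega>)\<^sup>2)" for L
        unfolding D_def using weighted_sum_square_le[OF \<alpha> sv2] by (intro AE_I2) simp
    qed measurable
  qed
  show ?thesis
    unfolding eq[symmetric] by (rule LIMSEQ_le[OF lim1 lim2]) (use le in blast)
qed

section \<open>Test functions that detect a digit word\<close>

text \<open>Orbit points meet the trapezoid over the cell of \<open>w\<close> only on its plateau or
  outside its support, so there it acts as an exact indicator. As there are finitely many words of
  length \<open>L\<close>, the least of their constants serves all of them.\<close>

lemma uniform_cell_bump:
  fixes g :: real
  assumes g: "0 < g" "g < 2" and b: "2 \<le> b" and N: "1 \<le> N"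
  shows "\<exists>k>0. \<forall>w\<in>{0..<int b ^ L}. \<exists>\<phi>. \<phi> 1 = 0 \<and>
    (\<forall>x\<in>orbit_avoiding_set b N. \<forall>n. \<phi> (frac (real b ^ n * x)) = (if digit_word b L n x = w then 1 else 0)) \<and>
    (\<forall>(I::'i set) c p. p ` I \<subseteq> {0..1} \<longrightarrow>
      k * (\<Sum>i\<in>I. c i * \<phi> (p i))\<^sup>2 \<le> (\<Sum>i\<in>I. \<Sum>j\<in>I. c i * c j * fbm_covariance g (p i) (p j)))"
proof -
  define Q where "Q k w \<phi> \<longleftrightarrow> \<phi> 1 = 0 \<and>
    (\<forall>x\<in>orbit_avoiding_set b N. \<forall>n. \<phi> (frac (real b ^ n * x)) = (if digit_word b L n x = w then 1 else 0)) \<and>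
    (\<forall>(I::'i set) c p. p ` I \<subseteq> {0..1} \<longrightarrow>
      k * (\<Sum>i\<in>I. c i * \<phi> (p i))\<^sup>2 \<le> (\<Sum>i\<in>I. \<Sum>j\<in>I. c i * c j * fbm_covariance g (p i) (p j)))"
    for k w and \<phi> :: "real \<Rightarrow> real"
  let ?S = "{0..<int b ^ L}"
  have mono: "Q k' w \<phi>" if "Q k w \<phi>" "k' \<le> k" for k k' w \<phi>
    using that unfolding Q_def by (meson mult_right_mono order_trans zero_le_power2)
  have "\<exists>k \<phi>. k > 0 \<and> Q k w \<phi>" if w: "w \<in> ?S" for w
  proof -
    define l r h where "l = of_int w / real b ^ L" and "r = (of_int w + 1) / real b ^ L"
      and "h = (1 / real b ^ N) / real b ^ L"
    have bL: "real b ^ L > 0" using b by simp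
    \<comment> \<open>Both margins fit into the cell because \<open>real b ^ N\<close> is at least
      2.\<close>
    have "real b ^ 1 \<le> real b ^ N" using b N by (intro power_increasing) auto
    moreover have "2 \<le> real b ^ 1" using b by simp
    ultimately have "2 \<le> real b ^ N" by linarith
    then have "2 * (1 / real b ^ N) \<le> 1" using b by simp
    then have "of_int w + 2 * (1 / real b ^ N) \<le> of_int w + 1" by simp
    then have "(of_int w + 2 * (1 / real b ^ N)) / real b ^ L \<le> r"
      unfolding r_def using bL by (intro divide_right_mono) auto
    then have lr: "l + 2 * h \<le> r" by (simp add: l_def h_def add_divide_distrib)
    have "w + 1 \<le> int b ^ L" using w by simp
    then have "of_int (w + 1) \<le> (of_int (int b ^ L) :: real)" by (simp only: of_int_le_iff)
    then have r1: "r \<le> 1" using bL by (simp add: r_def)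
    have l0: "0 \<le> l" "0 < h" using w b by (auto simp: l_def h_def)
    obtain \<phi> k where k: "k > 0" and \<phi>: "\<phi> 1 = 0" "\<forall>s\<in>{l + h..r - h}. \<phi> s = 1"
        "\<forall>s\<in>{0..1}. s \<le> l \<or> r \<le> s \<longrightarrow> \<phi> s = 0"
      and dom: "\<forall>(I::'i set) c p. p ` I \<subseteq> {0..1} \<longrightarrow>
      k * (\<Sum>i\<in>I. c i * \<phi> (p i))\<^sup>2 \<le> (\<Sum>i\<in>I. \<Sum>j\<in>I. c i * c j * fbm_covariance g (p i) (p j))"
      using fbm_covariance_dominates_bump[OF g l0 lr r1, where 'i = 'i] by (elim exE conjE) (rule that)
    have "\<phi> (frac (real b ^ n * x)) = (if digit_word b L n x = w then 1 else 0)"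
      if "x \<in> orbit_avoiding_set b N" for x n
    proof -
      have b0: "0 < b" using b by simp
      have z: "frac (real b ^ n * x) \<in> {0..1}" using less_imp_le[OF frac_lt_1] by simp
      show ?thesis
      proof (cases "digit_word b L n x = w")
        case True
        with orbit_word_cell(1)[OF that b0 True] show ?thesis
          using \<phi>(2) unfolding l_def r_def h_def by simp
      next
        case False
        with orbit_word_cell(2)[OF that b0 False] show ?thesis
          using bspec[OF \<phi>(3) z] unfolding l_def r_def by simp
      qed
    qed
    then show ?thesis using k \<phi>(1) dom unfolding Q_def by blast
  qed
  then obtain K \<Phi> where K: "\<And>w. w \<in> ?S \<Longrightarrow> K w > 0 \<and> Q (K w) w (\<Phi> w)" by metis
  define k where "k = Min (K ` ?S)"
  have "0 \<in> ?S" using b by simp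
  then have "K ` ?S \<noteq> {}" by blast
  then have "k > 0" using K by (simp add: k_def)
  moreover have "Q k w (\<Phi> w)" if "w \<in> ?S" for w
  proof -
    have "k \<le> K w" unfolding k_def using that by (intro Min_le) auto
    then show ?thesis by (rule mono[OF conjunct2[OF K[OF that]]])
  qed
  ultimately have "\<exists>k>0. \<forall>w\<in>?S. \<exists>\<phi>. Q k w \<phi>" by blast
  then show ?thesis unfolding Q_def .
qed

section \<open>Increments of the Wiener-Weierstrass bridge on \<open>T_N\<close>\<close>

theorem proposition3p9:
  fixes M :: "'a measure" and W :: "real \<Rightarrow> 'a \<Rightarrow> real" and \<kappa> :: "real \<Rightarrow> real"
    and H \<tau> \<alpha> :: real and b N :: nat
  assumes "prob_space M"
    and "0 < H" and "H < 1"
    and "continuous_fBm M H W"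
    and "\<kappa> ` {0..1} \<subseteq> {0..1}" and "\<kappa> 0 = 0" and "\<kappa> 1 = 1"
    and "H < \<tau>" and "\<tau> \<le> 1" and "holder_on \<tau> {0..1} \<kappa>"
    and "0 < \<alpha>" and "\<alpha> < 1" and "2 \<le> b"
    and "H > roughness_exponent \<alpha> b" and "H > 1 / 2"
    and "1 \<le> N"
  shows "\<exists>c>0. \<exists>\<delta>>0. \<forall>s\<in>orbit_avoiding_set b N. \<forall>t\<in>orbit_avoiding_set b N.
           0 < \<bar>t - s\<bar> \<and> \<bar>t - s\<bar> < \<delta> \<longrightarrow>
           prob_space.expectation M
             (\<lambda>\<omega>. \<bar>wiener_weierstrass_bridge \<alpha> b \<kappa> W t \<omega> - wiener_weierstrass_bridge \<alpha> b \<kappa> W s \<omega>\<bar>\<^sup>2)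
           \<ge> c * \<bar>t - s\<bar> powr (2 * roughness_exponent \<alpha> b)"
proof -
  note \<alpha> = \<open>0 < \<alpha>\<close> \<open>\<alpha> < 1\<close> and b = \<open>2 \<le> b\<close>
  define K where "K = roughness_exponent \<alpha> b"
  define T where "T = orbit_avoiding_set b N"
  let ?Y = "wiener_weierstrass_bridge \<alpha> b \<kappa> W"
  let ?d = "digit_word b 1"
  have b0: "0 < b" using b by simp
  \<comment> \<open>Since \<open>H < 1\<close>, the hypothesis that \<open>H\<close> exceeds the
    roughness exponent excludes the value 1 of the minimum, so the logarithm is the active
    branch.\<close>
  have "K < 1" using assms(14) \<open>H < 1\<close> by (simp add: K_def)
  then have K: "K = - log (real b) \<alpha>" by (auto simp: K_def roughness_exponent_def min_def split: if_splits)
  have "log (real b) \<alpha> < log (real b) 1" using \<alpha> b by (subst log_less_cancel_iff) auto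
  then have K0: "0 < K" by (simp add: K)
  have \<alpha>K: "real b powr (- K) = \<alpha>" using K \<alpha> b by simp
  \<comment> \<open>\<open>R\<close> is the largest shift for which recurrence of the word must be
    excluded: later occurrences together weigh at most half of the leading term.\<close>
  obtain R where R: "\<alpha> ^ R < (1 - \<alpha>) / 2" using real_arch_pow_inv[of "(1 - \<alpha>) / 2" \<alpha>] \<alpha> by auto
  have R': "\<alpha> ^ Suc R / (1 - \<alpha>) \<le> 1 / 2"
  proof -
    have "\<alpha> ^ Suc R \<le> \<alpha> ^ R" using \<alpha> by (intro power_decreasing) auto
    then have "\<alpha> ^ Suc R \<le> 1 / 2 * (1 - \<alpha>)" using R by linarith
    then show ?thesis using \<alpha> by (simp only: pos_divide_le_eq diff_gt_0_iff_gt)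
  qed
  \<comment> \<open>The smallest prefix length that \<open>prefix_word_not_both_recurrent\<close>
    allows for shifts up to \<open>R\<close>; words have one more letter, the one that
    differs.\<close>
  define q where "q = 2 * R"
  obtain k where k: "k > 0" "\<forall>w\<in>{0..<int b ^ Suc q}. \<exists>\<phi>. \<phi> 1 = 0 \<and>
    (\<forall>x\<in>T. \<forall>n. \<phi> (frac (real b ^ n * x)) = (if digit_word b (Suc q) n x = w then 1 else 0)) \<and>
    (\<forall>(I::(nat \<times> nat) set) c p. p ` I \<subseteq> {0..1} \<longrightarrow>
      k * (\<Sum>i\<in>I. c i * \<phi> (p i))\<^sup>2
        \<le> (\<Sum>i\<in>I. \<Sum>j\<in>I. c i * c j * fbm_covariance (2 * H) (p i) (p j)))"
  proof -
    have "0 < 2 * H" "2 * H < 2" using assms by auto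
    from uniform_cell_bump[OF this b \<open>1 \<le> N\<close>, where L = "Suc q" and 'i = "nat \<times> nat"] that
    show thesis unfolding T_def by blast
  qed
  \<comment> \<open>Here \<open>m\<close> is the place where the word starts, and the word is read
    off \<open>x\<close>. Occurrences before \<open>m\<close> cancel by \<open>agree\<close>, and
    \<open>new\<close> keeps the word out of \<open>y\<close> from \<open>m\<close> to
    \<open>m + R\<close>, so that only later terms can be negative.\<close>
  have key: "k / 4 * \<alpha> ^ (2 * m) \<le> (\<integral>\<omega>. \<bar>?Y x \<omega> - ?Y y \<omega>\<bar>\<^sup>2 \<partial>M)"
    if x: "x \<in> T" and y: "y \<in> T"
      and agree: "\<And>n. n < m \<Longrightarrow> digit_word b (Suc q) n x = digit_word b (Suc q) n y"
      and new: "\<And>r. r \<le> R \<Longrightarrow> digit_word b (Suc q) (m + r) y \<noteq> digit_word b (Suc q) m x" for x y m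
  proof -
    define w where "w = digit_word b (Suc q) m x"
    have "w \<in> {0..<int b ^ Suc q}" using digit_word_range[OF b0, of "Suc q" m x] by (simp only: w_def atLeastLessThan_iff)
    from bspec[OF k(2) this] obtain \<phi> where \<phi>1: "\<phi> 1 = 0"
      and \<phi>: "\<forall>x\<in>T. \<forall>n. \<phi> (frac (real b ^ n * x)) = (if digit_word b (Suc q) n x = w then 1 else 0)"
      and dom: "\<forall>(I::(nat \<times> nat) set) c p. p ` I \<subseteq> {0..1} \<longrightarrow>
      k * (\<Sum>i\<in>I. c i * \<phi> (p i))\<^sup>2
        \<le> (\<Sum>i\<in>I. \<Sum>j\<in>I. c i * c j * fbm_covariance (2 * H) (p i) (p j))"
      by blast
    define e where "e n = \<phi> (frac (real b ^ n * x)) - \<phi> (frac (real b ^ n * y))" for n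
    have e1: "\<bar>e n\<bar> \<le> 1" for n by (simp add: e_def \<phi> x y)
    have bound: "\<alpha> ^ m / 2 \<le> (\<Sum>n. \<alpha> ^ n * e n)"
    proof (rule suminf_leading_term_bound[OF \<alpha> R' e1])
      show "e m = 1" using new[of 0] by (simp add: e_def \<phi> x y w_def)
      show "0 \<le> e n" if "n \<le> m + R" for n
      proof (cases "n < m")
        case True
        then show ?thesis using agree by (simp add: e_def \<phi> x y)
      next
        case False
        then show ?thesis using new[of "n - m"] that by (simp add: e_def \<phi> x y w_def)
      qed
    qed
    have summ: "summable (\<lambda>n. \<alpha> ^ n * e n)"
    proof (rule summable_comparison_test'[of "\<lambda>n. \<alpha> ^ n" 0])
      show "norm (\<alpha> ^ n * e n) \<le> \<alpha> ^ n" for n using e1[of n] \<alpha> by (simp add: abs_mult mult_left_le)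
    qed (use \<alpha> in \<open>simp add: summable_geometric\<close>)
    have orbit: "frac (real b ^ n * z) \<in> {0<..1}" if "z \<in> T" for z n
      using orbit_frac_bounds[of z b N n] that b0 by (simp add: T_def)
    have "k / 4 * \<alpha> ^ (2 * m) = k * (\<alpha> ^ m / 2)\<^sup>2"
      by (simp add: power_divide power_mult[symmetric] mult.commute)
    also have "\<dots> \<le> k * (\<Sum>n. \<alpha> ^ n * e n)\<^sup>2"
      using bound k(1) \<alpha> by (intro mult_left_mono power_mono) auto
    also have "\<dots> \<le> (\<integral>\<omega>. \<bar>?Y x \<omega> - ?Y y \<omega>\<bar>\<^sup>2 \<partial>M)"
      unfolding e_def wiener_weierstrass_bridge_def
      by (rule bridge_series_variance_lower_bound[OF assms(4,2,5) \<alpha> orbit[OF x] orbit[OF y] dom[rule_format] \<phi>1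
            summ[unfolded e_def]])
    finally show ?thesis .
  qed
  \<comment> \<open>If the first \<open>q\<close> digits differed, \<open>real b ^ q * s\<close> and
    \<open>real b ^ q * t\<close> would lie in different unit intervals, each at least
    \<open>1 / real b ^ N\<close> from the ends. Being closer than \<open>\<delta>\<close> thus
    leaves room for a word of length \<open>q + 1\<close> ending at the first difference.\<close>
  define \<delta> where "\<delta> = 1 / real b ^ N / real b ^ q"
  have "k / 4 * \<bar>t - s\<bar> powr (2 * K) \<le> (\<integral>\<omega>. \<bar>?Y t \<omega> - ?Y s \<omega>\<bar>\<^sup>2 \<partial>M)"
    if s: "s \<in> T" and t: "t \<in> T" and st: "0 < \<bar>t - s\<bar>" "\<bar>t - s\<bar> < \<delta>" for s t
  proof -
    \<comment> \<open>The point 1 is not in \<open>T\<close>, its fractional part being 0; so the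
      integer part of a point of \<open>T\<close> is 0, and
      \<open>\<lfloor>real b ^ n * z\<rfloor>\<close> encodes its first \<open>n\<close>
      digits.\<close>
    have unit: "0 \<le> z" "z < 1" "\<lfloor>z\<rfloor> = 0" if "z \<in> T" for z
    proof -
      have "0 < frac z" "0 \<le> z" "z \<le> 1"
        using orbit_frac_bounds[of z b N 0] that b0 by (auto simp: T_def orbit_avoiding_set_def)
      then show "0 \<le> z" "z < 1" by (cases "z = 1"; simp)+
      then show "\<lfloor>z\<rfloor> = 0" by (simp add: floor_eq_iff)
    qed
    have floor_word: "\<lfloor>real b ^ n * z\<rfloor> = digit_word b n 0 z" if "z \<in> T" for z n
      using unit[OF that] by (simp add: digit_word_eq_diff)
    have close: "\<bar>t - s\<bar> \<le> 1 / real b ^ n" if "digit_word b n 0 t = digit_word b n 0 s" for n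
    proof -
      have "\<bar>real b ^ n * t - real b ^ n * s\<bar> \<le> 1"
        using that floor_word[OF s, of n] floor_word[OF t, of n] by linarith
      then have "real b ^ n * \<bar>t - s\<bar> \<le> 1" by (simp add: right_diff_distrib[symmetric] abs_mult)
      then show ?thesis using b0 by (simp add: field_simps)
    qed
    have "\<exists>n. ?d n t \<noteq> ?d n s"
    proof (rule ccontr)
      assume "\<not> ?thesis"
      then have "\<bar>t - s\<bar> \<le> 1 / real b ^ n" for n
        by (intro close) (simp add: digit_word_eq_iff[OF b0, of n])
      moreover obtain n where "(1 / real b) ^ n < \<bar>t - s\<bar>"
        using real_arch_pow_inv[of "\<bar>t - s\<bar>" "1 / real b"] st b by auto
      ultimately show False by (metis not_le power_one_over)
    qed
    define m where "m = (LEAST n. ?d n t \<noteq> ?d n s)"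
    have m: "?d m t \<noteq> ?d m s" unfolding m_def using LeastI_ex[OF \<open>\<exists>n. ?d n t \<noteq> ?d n s\<close>] .
    have below: "?d n t = ?d n s" if "n < m" for n using not_less_Least[of n] that unfolding m_def by blast
    have qm: "q \<le> m"
    proof (rule ccontr)
      assume "\<not> q \<le> m"
      then have "digit_word b q 0 t \<noteq> digit_word b q 0 s" using m by (auto simp: digit_word_eq_iff[OF b0, of q] intro!: exI[of _ m])
      then have ne: "\<lfloor>real b ^ q * t\<rfloor> \<noteq> \<lfloor>real b ^ q * s\<rfloor>" by (simp add: floor_word s t)
      have sep: "1 / real b ^ N \<le> frac (real b ^ q * z)" if "z \<in> T" for z
        using that by (auto simp: T_def orbit_avoiding_set_def)
      have "0 < 1 / real b ^ N" using b0 by simp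
      then have "1 / real b ^ N \<le> \<bar>real b ^ q * t - real b ^ q * s\<bar>"
        using ne sep[OF s] sep[OF t] frac_lt_1[of "real b ^ q * s"] frac_lt_1[of "real b ^ q * t"]
        unfolding frac_def by linarith
      then have "1 / real b ^ N \<le> real b ^ q * \<bar>t - s\<bar>" by (simp add: right_diff_distrib[symmetric] abs_mult)
      then show False using st(2) b0 by (simp add: \<delta>_def field_simps)
    qed
    \<comment> \<open>The word occupies the places \<open>m0\<close> to \<open>m\<close>, with the
      disagreement as its last letter; every window starting earlier ends before
      \<open>m\<close>.\<close>
    define m0 where "m0 = m - q"
    have m0: "m0 + q = m" using qm by (simp add: m0_def)
    have agree: "digit_word b (Suc q) n t = digit_word b (Suc q) n s" if "n < m0" for n
      using that m0 below by (simp add: digit_word_eq_iff[OF b0, of "Suc q"])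
    have new0: "digit_word b (Suc q) m0 t \<noteq> digit_word b (Suc q) m0 s"
      using m m0 by (auto simp: digit_word_eq_iff[OF b0, of "Suc q"] intro!: exI[of _ q])
    \<comment> \<open>Applied to both expansions shifted by \<open>m0\<close>. The alternative that
      holds decides whether the word comes from \<open>t\<close> or from \<open>s\<close>; shift 0
      is covered by \<open>new0\<close>.\<close>
    have "(\<forall>r\<in>{1..R}. \<exists>i\<le>q. ?d (m0 + (r + i)) s \<noteq> ?d (m0 + i) t) \<or>
          (\<forall>r\<in>{1..R}. \<exists>i\<le>q. ?d (m0 + (r + i)) t \<noteq> ?d (m0 + i) s)"
      using m m0 below by (intro prefix_word_not_both_recurrent) (auto simp: q_def)
    then have "k / 4 * \<alpha> ^ (2 * m0) \<le> (\<integral>\<omega>. \<bar>?Y t \<omega> - ?Y s \<omega>\<bar>\<^sup>2 \<partial>M)"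
    proof
      assume fresh: "\<forall>r\<in>{1..R}. \<exists>i\<le>q. ?d (m0 + (r + i)) s \<noteq> ?d (m0 + i) t"
      have "digit_word b (Suc q) (m0 + r) s \<noteq> digit_word b (Suc q) m0 t" if "r \<le> R" for r
      proof (cases "r = 0")
        case False
        then have "\<exists>i\<le>q. ?d (m0 + (r + i)) s \<noteq> ?d (m0 + i) t" using fresh that by auto
        then show ?thesis unfolding digit_word_eq_iff[OF b0, of "Suc q"] by (auto simp: less_Suc_eq_le add.assoc)
      qed (use new0 in simp)
      then show ?thesis using key[OF t s agree] by blast
    next
      assume fresh: "\<forall>r\<in>{1..R}. \<exists>i\<le>q. ?d (m0 + (r + i)) t \<noteq> ?d (m0 + i) s"
      have "digit_word b (Suc q) (m0 + r) t \<noteq> digit_word b (Suc q) m0 s" if "r \<le> R" for r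
      proof (cases "r = 0")
        case False
        then have "\<exists>i\<le>q. ?d (m0 + (r + i)) t \<noteq> ?d (m0 + i) s" using fresh that by auto
        then show ?thesis unfolding digit_word_eq_iff[OF b0, of "Suc q"] by (auto simp: less_Suc_eq_le add.assoc)
      qed (use new0 in simp)
      then have "k / 4 * \<alpha> ^ (2 * m0) \<le> (\<integral>\<omega>. \<bar>?Y s \<omega> - ?Y t \<omega>\<bar>\<^sup>2 \<partial>M)"
        using key[OF s t agree[symmetric]] by blast
      then show ?thesis by (simp add: abs_minus_commute)
    qed
    \<comment> \<open>Agreement on the first \<open>m\<close> digits bounds the distance by
      \<open>1 / real b ^ m\<close>, and \<open>real b powr (- K) = \<alpha>\<close> converts its
      power into \<open>\<alpha> ^ (2 * m)\<close>.\<close>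
    moreover have "\<bar>t - s\<bar> powr (2 * K) \<le> \<alpha> ^ (2 * m0)"
    proof -
      have "\<bar>t - s\<bar> \<le> 1 / real b ^ m" using below by (intro close) (simp add: digit_word_eq_iff[OF b0, of m])
      also have "\<dots> = real b powr (- real m)" using b0 by (simp add: powr_minus powr_realpow divide_inverse)
      finally have "\<bar>t - s\<bar> powr (2 * K) \<le> (real b powr (- real m)) powr (2 * K)"
        using K0 by (intro powr_mono2) auto
      also have "\<dots> = (real b powr (- K)) powr (real (2 * m))" by (simp add: powr_powr mult_ac)
      also have "\<dots> = \<alpha> ^ (2 * m)" unfolding \<alpha>K using \<alpha>(1) by (rule powr_realpow)
      also have "\<dots> \<le> \<alpha> ^ (2 * m0)" using \<alpha> m0 by (intro power_decreasing) auto
      finally show ?thesis .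
    qed
    then have "k / 4 * \<bar>t - s\<bar> powr (2 * K) \<le> k / 4 * \<alpha> ^ (2 * m0)"
      using k(1) by (intro mult_left_mono) auto
    ultimately show ?thesis by linarith
  qed
  moreover have "k / 4 > 0" "\<delta> > 0" using k(1) b0 by (auto simp: \<delta>_def)
  ultimately show ?thesis unfolding K_def T_def by blast
qed

end
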